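(* Let $k>2$, and let $\mathcal D$ be a distribution over $\mathbb R^d$ with mean $0$ and $\sigma_k(\mathcal D)\le1$. Let $X_1,\dots,X_m\sim\mathcal D$ i.i.d. and $X=\frac1m\sum_{i=1}^mX_i$. There exist $t_1=O\big(\sqrt{d\log m/m}\big)$ and $t_2=\Omega\big(\sqrt d\,\log^{-1/(k-2)}m\big)$ such that for all $t\in[t_1,t_2]$, \[ \Pr[\|X\|_2\ge t]=\tilde O\left(\frac{d^{k/2}}{m^{k-1}t^k}+e^{-mt^2/d}\right). \]
   Context: $\sigma_k(\mathcal D)=\sup_{\|v\|_2=1}\mathbb E_{Y\sim\mathcal D}[|\langle Y-\mathbb E Y,v\rangle|^k]^{1/k}$. $\tilde O$ hides factors depending only on $k$ and polylogarithmic factors in $m$. *)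

theory Defs
  imports "HOL-Probability.Probability"
begin

text \<open>
  The dimension \<open>d\<close> has to be quantified inside the statement, since the implied constants may not
  depend on it.  Hence \<open>\<real>\<^sup>d\<close> is modelled by the product space of \<open>d\<close> copies of the Borel reals,
  with vectors as functions of which only the values on \<open>{..<d}\<close> matter.
\<close>

definition distribution_on :: "nat \<Rightarrow> (nat \<Rightarrow> real) measure \<Rightarrow> bool" where
  "distribution_on d D \<longleftrightarrow> prob_space D \<and> sets D = sets (Pi\<^sub>M {..<d} (\<lambda>_. borel :: real measure))"

definition vec_inner :: "nat \<Rightarrow> (nat \<Rightarrow> real) \<Rightarrow> (nat \<Rightarrow> real) \<Rightarrow> real" where
  "vec_inner d x y = (\<Sum>j<d. x j * y j)"

definition vec_norm :: "nat \<Rightarrow> (nat \<Rightarrow> real) \<Rightarrow> real" where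
  "vec_norm d x = L2_set x {..<d}"

definition vec_mean :: "(nat \<Rightarrow> real) measure \<Rightarrow> nat \<Rightarrow> real" where
  "vec_mean D = (\<lambda>j. LINT y|D. y j)"

text \<open>The mean exists (every coordinate is integrable) and equals \<open>\<mu>\<close>.\<close>

definition has_mean :: "nat \<Rightarrow> (nat \<Rightarrow> real) measure \<Rightarrow> (nat \<Rightarrow> real) \<Rightarrow> bool" where
  "has_mean d D \<mu> \<longleftrightarrow> (\<forall>j<d. has_bochner_integral D (\<lambda>y. y j) (\<mu> j))"

text \<open>Powers with a positive exponent, so \<open>\<infinity>\<close> is sent to \<open>\<infinity>\<close>.\<close>

definition ennreal_powr :: "ennreal \<Rightarrow> real \<Rightarrow> ennreal" where
  "ennreal_powr x p = (if x = top then top else ennreal (enn2real x powr p))"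

text \<open>
  The value is an extended real, so that an infinite \<open>k\<close>-th moment in some direction gives
  \<open>moment_sigma d k D = \<infinity>\<close>; a Bochner integral would silently evaluate to 0 there.
\<close>

definition moment_sigma :: "nat \<Rightarrow> real \<Rightarrow> (nat \<Rightarrow> real) measure \<Rightarrow> ennreal" where
  "moment_sigma d k D =
     (SUP v \<in> {v. vec_norm d v = 1}.
        ennreal_powr
          (\<integral>\<^sup>+ y. ennreal (\<bar>vec_inner d (\<lambda>j. y j - vec_mean D j) v\<bar> powr k) \<partial>D) (1 / k))"

definition sample_mean :: "nat \<Rightarrow> (nat \<Rightarrow> nat \<Rightarrow> real) \<Rightarrow> nat \<Rightarrow> real" where
  "sample_mean m X = (\<lambda>j. (\<Sum>i<m. X i j) / real m)"

text \<open>
  \<open>\<Pr>[\<parallel>X\<parallel>\<^sub>2 \<ge> t]\<close> for the average \<open>X\<close> of \<open>m\<close> i.i.d. samples from \<open>D\<close>, realised as the coordinates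
  of the product measure \<open>D\<^sup>m\<close>.  The lemma \<open>iid_mean_tail_prob\<close> shows that every other realisation
  gives the same value.
\<close>

definition mean_tail_prob :: "nat \<Rightarrow> nat \<Rightarrow> (nat \<Rightarrow> real) measure \<Rightarrow> real \<Rightarrow> real" where
  "mean_tail_prob d m D t =
     measure (Pi\<^sub>M {..<m} (\<lambda>_. D))
       {X \<in> space (Pi\<^sub>M {..<m} (\<lambda>_. D)). t \<le> vec_norm d (sample_mean m X)}"

lemma sample_mean_norm_measurable:
  assumes "distribution_on d D"
  shows "(\<lambda>X. vec_norm d (sample_mean m X)) \<in> borel_measurable (Pi\<^sub>M {..<m} (\<lambda>_. D))"
proof -
  have sD: "sets D = sets (Pi\<^sub>M {..<d} (\<lambda>_. borel :: real measure))"
    using assms by (simp add: distribution_on_def)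
  have *: "(\<lambda>y. y j) \<in> borel_measurable D" if "j < d" for j
    unfolding measurable_cong_sets[OF sD refl]
    using that by (intro measurable_component_singleton) auto
  have [measurable]: "(\<lambda>X. X i j) \<in> borel_measurable (Pi\<^sub>M {..<m} (\<lambda>_. D))" if "i < m" "j < d" for i j
  proof -
    have "(\<lambda>X. X i) \<in> measurable (Pi\<^sub>M {..<m} (\<lambda>_. D)) D"
      using that by (intro measurable_component_singleton) auto
    from measurable_compose[OF this *[OF that(2)]] show ?thesis .
  qed
  show ?thesis
    unfolding vec_norm_def sample_mean_def L2_set_def by measurable
qed

lemma (in prob_space) iid_mean_tail_prob:
  assumes D: "distribution_on d D" and m: "m \<ge> 1"
    and X: "indep_vars (\<lambda>_. D) X {..<m}" and dist: "\<And>i. i < m \<Longrightarrow> distr M D (X i) = D"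
  shows "prob {\<omega> \<in> space M. t \<le> vec_norm d (sample_mean m (\<lambda>i. X i \<omega>))} = mean_tail_prob d m D t"
proof -
  let ?P = "Pi\<^sub>M {..<m} (\<lambda>_. D)" and ?f = "\<lambda>\<omega>. \<lambda>i\<in>{..<m}. X i \<omega>"
  have rv: "random_variable D (X i)" if "i \<in> {..<m}" for i
    using X that by (auto simp: indep_vars_def)
  have f: "?f \<in> measurable M ?P"
    using rv by (intro measurable_restrict) auto
  have "distr M ?P ?f = Pi\<^sub>M {..<m} (\<lambda>i. distr M D (X i))"
    using X rv m by (subst indep_vars_iff_distr_eq_PiM'[symmetric]) (auto simp: lessThan_empty_iff)
  also have "\<dots> = ?P"
    using dist by (intro PiM_cong) auto
  finally have eq: "distr M ?P ?f = ?P" .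
  have S: "{X \<in> space ?P. t \<le> vec_norm d (sample_mean m X)} \<in> sets ?P" (is "?S \<in> _")
    using sample_mean_norm_measurable[OF D, of m] by measurable
  have "mean_tail_prob d m D t = measure (distr M ?P ?f) ?S"
    unfolding eq mean_tail_prob_def ..
  also have "\<dots> = prob (?f -` ?S \<inter> space M)"
    by (rule measure_distr[OF f S])
  also have "?f -` ?S \<inter> space M = {\<omega> \<in> space M. t \<le> vec_norm d (sample_mean m (\<lambda>i. X i \<omega>))}"
    using measurable_space[OF f] by (auto simp: sample_mean_def)
  finally show ?thesis ..
qed

end

theory Submission
  imports Defs
begin

text \<open>
  Truncate the samples at norm \<open>R = m t / (2 L)\<close> with \<open>L = 2 (k - 1) ln m\<close>.  By Markov's inequality
  and the power mean bound \<open>E \<parallel>Y\<parallel>\<^sup>k \<le> d\<^bsup>k/2\<^esup>\<close>, some sample exceeds \<open>R\<close> with probability at most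
  \<open>m d\<^bsup>k/2\<^esup> / R\<^sup>k\<close>, which is the polynomial term up to the factor \<open>(2 L)\<^sup>k\<close>.  For the truncated sum
  \<open>S\<close> a dimension-free Bernstein bound is obtained from the potential
  \<open>exp (sqrt (1 + \<parallel>\<lambda>S\<parallel>\<^sup>2))\<close> with \<open>\<lambda> R = 1/2\<close>: each summand increases its expectation by a factor of
  at most \<open>exp (6 \<lambda>\<^sup>2 d)\<close>.  For \<open>t\<^sup>2 \<ge> 24 (k - 1) d ln m / m\<close> this leaves probability at most
  \<open>e m\<^bsup>-(k-1)\<^esup>\<close>, which the polynomial term dominates as long as \<open>t \<le> sqrt d\<close>.
\<close>

section \<open>A quadratic bound for the exponential\<close>

text \<open>For negative \<open>z\<close> the quadratic Taylor lower bound of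
  \<open>exp (- z)\<close> is inverted: with \<open>w = - z\<close>, the product of
  \<open>1 - w + w\<^sup>2\<close> and that bound is at least 1.\<close>

lemma exp_le_quadratic:
  fixes z :: real
  assumes "\<bar>z\<bar> \<le> 1"
  shows "exp z \<le> 1 + z + z\<^sup>2"
proof (cases "z \<ge> 0")
  case True
  then show ?thesis using exp_bound[of z] assms by simp
next
  case False
  define w where "w = - z"
  have w: "w \<ge> 0" using False by (simp add: w_def)
  have "exp (- w) = 1 / exp w" by (simp add: exp_minus field_simps)
  also have "\<dots> \<le> 1 / (1 + w + w\<^sup>2 / 2)"
    using exp_lower_Taylor_quadratic[OF w] w by (intro divide_left_mono) (auto intro!: mult_pos_pos add_pos_nonneg)
  also have "\<dots> \<le> 1 - w + w\<^sup>2"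
  proof -
    have "(1 - w + w\<^sup>2) * (1 + w + w\<^sup>2 / 2) = 1 + (w\<^sup>2 + w^3 + w^4) / 2"
      by (simp add: field_simps power2_eq_square power3_eq_cube power4_eq_xxxx)
    also have "\<dots> \<ge> 1" using w by simp
    finally show ?thesis using w by (simp add: divide_le_eq add_pos_nonneg)
  qed
  finally show ?thesis by (simp add: w_def)
qed

section \<open>Smoothed norm, truncation and the one-step estimate\<close>

text \<open>Adding 1 under the root smooths the Euclidean norm at the origin and keeps the value at
  least 1, so that it can be divided by.\<close>

definition smooth_norm :: "nat \<Rightarrow> (nat \<Rightarrow> real) \<Rightarrow> real" where
  "smooth_norm d x = sqrt (1 + (\<Sum>j<d. (x j)\<^sup>2))"

text \<open>Long vectors become zero instead of being rescaled to length \<open>R\<close>, so a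
  discarded sample leaves the potential unchanged.\<close>

definition truncate :: "nat \<Rightarrow> real \<Rightarrow> (nat \<Rightarrow> real) \<Rightarrow> nat \<Rightarrow> real" where
  "truncate d R y = (if vec_norm d y \<le> R then y else (\<lambda>_. 0))"

lemma vec_norm_nonneg [simp]: "0 \<le> vec_norm d x"
  by (simp add: vec_norm_def)

lemma vec_norm_power2: "(vec_norm d x)\<^sup>2 = (\<Sum>j<d. (x j)\<^sup>2)"
  by (simp add: vec_norm_def L2_set_def sum_nonneg)

lemma vec_norm_scale: "0 \<le> c \<Longrightarrow> vec_norm d (\<lambda>j. c * x j) = c * vec_norm d x"
  by (simp add: vec_norm_def L2_set_right_distrib)

lemma vec_inner_scale_right: "vec_inner d x (\<lambda>j. c * y j) = c * vec_inner d x y"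
  by (simp add: vec_inner_def sum_distrib_left mult_ac)

lemma smooth_norm_ge_1: "1 \<le> smooth_norm d x"
  by (simp add: smooth_norm_def sum_nonneg)

lemma vec_norm_le_smooth_norm: "vec_norm d x \<le> smooth_norm d x"
  by (simp add: smooth_norm_def vec_norm_def L2_set_def)

lemma smooth_norm_power2: "(smooth_norm d x)\<^sup>2 = 1 + (\<Sum>j<d. (x j)\<^sup>2)"
  by (simp add: smooth_norm_def sum_nonneg add_nonneg_nonneg)

text \<open>Cauchy-Schwarz, in the form used after division by \<open>smooth_norm d x\<close>: the
  linear part of an increment is bounded by \<open>vec_norm d y\<close>, however large
  \<open>x\<close> is.\<close>

lemma abs_vec_inner_le: "\<bar>vec_inner d x y\<bar> \<le> smooth_norm d x * vec_norm d y"
proof -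
  have "\<bar>vec_inner d x y\<bar> \<le> (\<Sum>j<d. \<bar>x j\<bar> * \<bar>y j\<bar>)"
    unfolding vec_inner_def by (rule order_trans[OF sum_abs]) (simp add: abs_mult)
  also have "\<dots> \<le> vec_norm d x * vec_norm d y"
    unfolding vec_norm_def by (rule L2_set_mult_ineq)
  also have "\<dots> \<le> smooth_norm d x * vec_norm d y"
    by (intro mult_right_mono vec_norm_le_smooth_norm) simp
  finally show ?thesis .
qed

text \<open>The square root lies below its tangent.\<close>

lemma smooth_norm_add_le:
  "smooth_norm d (\<lambda>j. x j + y j)
     \<le> smooth_norm d x + (vec_inner d x y + (vec_norm d y)\<^sup>2 / 2) / smooth_norm d x"
proof -
  let ?N = "smooth_norm d x" and ?M = "smooth_norm d (\<lambda>j. x j + y j)"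
  have "?M\<^sup>2 = ?N\<^sup>2 + 2 * vec_inner d x y + (vec_norm d y)\<^sup>2"
    by (simp add: smooth_norm_power2 vec_norm_power2 vec_inner_def power2_sum sum.distrib
        sum_distrib_left mult_ac)
  moreover have "2 * (?M * ?N) \<le> ?M\<^sup>2 + ?N\<^sup>2"
    using sum_squares_bound[of ?M ?N] by simp
  ultimately have "?M * ?N \<le> ?N * ?N + (vec_inner d x y + (vec_norm d y)\<^sup>2 / 2)"
    by (simp add: power2_eq_square)
  then show ?thesis
    using smooth_norm_ge_1[of d x] by (simp add: field_simps)
qed

text \<open>The tangent bound is exponentiated. The linear term is kept exactly because it will
  integrate to zero; only second-order terms are estimated.\<close>

lemma exp_smooth_norm_add_le:
  assumes y: "vec_norm d y \<le> 1 / 2"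
  shows "exp (smooth_norm d (\<lambda>j. x j + y j))
    \<le> exp (smooth_norm d x) * (1 + vec_inner d x y / smooth_norm d x + 3 * (vec_norm d y)\<^sup>2)"
proof -
  let ?N = "smooth_norm d x" and ?r = "vec_norm d y"
  define a where "a = vec_inner d x y / ?N"
  define b where "b = ?r\<^sup>2 / (2 * ?N)"
  have N: "?N \<ge> 1" by (rule smooth_norm_ge_1)
  have a: "\<bar>a\<bar> \<le> ?r"
    using abs_vec_inner_le[of d x y] N by (simp add: a_def abs_divide divide_le_eq mult_ac)
  have "?r\<^sup>2 / (2 * ?N) \<le> ?r\<^sup>2 / 2"
    using N by (intro divide_left_mono) auto
  then have b: "0 \<le> b" "b \<le> ?r\<^sup>2 / 2"
    using N by (auto simp: b_def)
  have r2: "?r\<^sup>2 \<le> ?r / 2"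
    using y mult_left_mono[of ?r "1/2" ?r] by (simp add: power2_eq_square)
  \<comment> \<open>Together, \<open>b\<close> and \<open>r2\<close> bound the second summand by
    \<open>?r / 4\<close>, hence the factor 5/4. As \<open>?r\<close> is at most 1/2, the sum stays
    below 1, the range of \<open>exp_le_quadratic\<close>.\<close>
  have ab: "\<bar>a + b\<bar> \<le> (5 / 4) * ?r" using a b r2 by linarith
  have "(a + b)\<^sup>2 \<le> ((5 / 4) * ?r)\<^sup>2"
    using ab by (metis abs_ge_zero power2_abs power_mono)
  then have sq: "(a + b)\<^sup>2 \<le> (25 / 16) * ?r\<^sup>2" by (simp add: power_mult_distrib power_divide)
  have "exp (smooth_norm d (\<lambda>j. x j + y j)) \<le> exp (?N + (a + b))"
    using smooth_norm_add_le[of d x y] by (simp add: a_def b_def add_divide_distrib)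
  also have "\<dots> = exp ?N * exp (a + b)" by (rule exp_add)
  also have "\<dots> \<le> exp ?N * (1 + (a + b) + (a + b)\<^sup>2)"
    using ab y by (intro mult_left_mono exp_le_quadratic) auto
  \<comment> \<open>The factor 3 absorbs 1/2 from \<open>b\<close> and 25/16 from the
    square.\<close>
  also have "\<dots> \<le> exp ?N * (1 + a + 3 * ?r\<^sup>2)"
    using b sq zero_le_power2[of ?r] by (intro mult_left_mono) (linarith | simp)+
  finally show ?thesis by (simp add: a_def)
qed

text \<open>
  The linear term contains the untruncated \<open>y\<close>, whose mean vanishes, so no centring of the
  truncated variable is needed: beyond the truncation level the quadratic term dominates.
\<close>

lemma exp_smooth_norm_truncate_le:
  assumes l: "0 < l" and R: "l * R = 1 / 2"
  shows "exp (smooth_norm d (\<lambda>j. x j + l * truncate d R y j))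
    \<le> exp (smooth_norm d x)
        * (1 + l * vec_inner d x y / smooth_norm d x + 3 * l\<^sup>2 * (vec_norm d y)\<^sup>2)"
proof (cases "vec_norm d y \<le> R")
  case True
  then have "vec_norm d (\<lambda>j. l * y j) \<le> 1 / 2"
    using l R by (simp add: vec_norm_scale flip: R)
  from exp_smooth_norm_add_le[OF this, of x] show ?thesis
    using True l
    by (simp add: truncate_def vec_norm_scale vec_inner_scale_right power_mult_distrib mult.assoc)
next
  case False
  let ?N = "smooth_norm d x" and ?r = "vec_norm d y"
  have N: "?N \<ge> 1" by (rule smooth_norm_ge_1)
  have lr: "l * ?r > 1 / 2" using False l by (simp flip: R)
  have "\<bar>vec_inner d x y / ?N\<bar> \<le> ?r"
    using abs_vec_inner_le[of d x y] N by (simp add: abs_divide divide_le_eq mult_ac)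
  then have "- ?r \<le> vec_inner d x y / ?N" by linarith
  then have "- (l * ?r) \<le> l * vec_inner d x y / ?N"
    using l mult_left_mono[of "- ?r" "vec_inner d x y / ?N" l] by simp
  moreover have "l * ?r \<le> 3 * l\<^sup>2 * ?r\<^sup>2"
  proof -
    have "(l * ?r) * 1 \<le> (l * ?r) * (3 * (l * ?r))"
      using lr by (intro mult_left_mono) auto
    then show ?thesis by (simp add: power2_eq_square mult_ac)
  qed
  ultimately have "0 \<le> l * vec_inner d x y / ?N + 3 * l\<^sup>2 * ?r\<^sup>2" by linarith
  then have "exp ?N * 1 \<le> exp ?N * (1 + l * vec_inner d x y / ?N + 3 * l\<^sup>2 * ?r\<^sup>2)"
    by (intro mult_left_mono) auto
  then show ?thesis using False by (simp add: truncate_def)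
qed

section \<open>Power mean bound for the norm\<close>

text \<open>Jensen's inequality for the convex power \<open>k / 2\<close>, applied to the squared
  coordinates.\<close>

lemma vec_norm_powr_le:
  assumes d: "d \<ge> 1" and k: "k \<ge> 2"
  shows "vec_norm d y powr k \<le> real d powr (k / 2 - 1) * (\<Sum>j<d. \<bar>y j\<bar> powr k)"
proof -
  define p where "p = k / 2"
  have p: "p \<ge> 1" using k by (simp add: p_def)
  have vn: "vec_norm d y powr k = (\<Sum>j<d. (y j)\<^sup>2) powr p"
    by (simp add: vec_norm_def L2_set_def powr_half_sqrt[symmetric] sum_nonneg powr_powr p_def)
  have pk: "(y j)\<^sup>2 powr p = \<bar>y j\<bar> powr k" for j
  proof -
    have "(y j)\<^sup>2 = \<bar>y j\<bar> powr 2" by (cases "y j = 0") (auto simp: powr_numeral)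
    then show ?thesis by (simp only: p_def powr_powr) simp
  qed
  \<comment> \<open>Jensen is applied to the nonzero coordinates only, so that all points are
    strictly positive. As \<open>p - 1\<close> is nonnegative, their number can be replaced by
    \<open>d\<close> at the end.\<close>
  define S where "S = {j. j < d \<and> y j \<noteq> 0}"
  have S: "finite S" "S \<subseteq> {..<d}" by (auto simp: S_def)
  have sumS: "(\<Sum>j<d. (y j)\<^sup>2) = (\<Sum>j\<in>S. (y j)\<^sup>2)"
    by (rule sum.mono_neutral_right) (auto simp: S_def)
  show ?thesis
  proof (cases "S = {}")
    case True
    then show ?thesis using sumS by (simp add: vn sum_nonneg)
  next
    case False
    define n where "n = real (card S)"
    have n: "n > 0" using False S(1) by (simp add: n_def card_gt_0_iff)
    have nd: "n \<le> real d" using card_mono[OF _ S(2)] by (simp add: n_def)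
    let ?A = "\<Sum>j\<in>S. (y j)\<^sup>2"
    have A: "?A > 0" using S(1) False by (intro sum_pos) (auto simp: S_def)
    have "(\<Sum>j\<in>S. (1 / n) *\<^sub>R (y j)\<^sup>2) powr p \<le> (\<Sum>j\<in>S. (1 / n) * ((y j)\<^sup>2 powr p))"
      using S(1) False n
      by (intro convex_on_sum[OF _ _ powr_convex[OF p]] ) (auto simp: n_def S_def)
    then have "(?A / n) powr p \<le> (\<Sum>j\<in>S. \<bar>y j\<bar> powr k) / n"
      by (simp add: pk flip: sum_distrib_left sum_divide_distrib)
    then have "?A powr p \<le> n powr p * ((\<Sum>j\<in>S. \<bar>y j\<bar> powr k) / n)"
      using n A by (simp add: powr_divide divide_le_eq mult_ac)
    also have "\<dots> = n powr (p - 1) * (\<Sum>j\<in>S. \<bar>y j\<bar> powr k)"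
      using n by (simp add: powr_diff)
    also have "\<dots> \<le> real d powr (p - 1) * (\<Sum>j<d. \<bar>y j\<bar> powr k)"
      using nd n p S by (intro mult_mono powr_mono2 sum_mono2 sum_nonneg) auto
    finally show ?thesis by (simp add: vn sumS p_def)
  qed
qed

section \<open>Moments and tails of a centred distribution\<close>

locale centered_distribution =
  fixes d :: nat and k :: real and D :: "(nat \<Rightarrow> real) measure"
  assumes d: "d \<ge> 1" and k: "k > 2"
    and distribution: "distribution_on d D" and mean0: "has_mean d D (\<lambda>_. 0)"
    and moment: "moment_sigma d k D \<le> 1"
begin

lemma sets_D: "sets D = sets (Pi\<^sub>M {..<d} (\<lambda>_. borel :: real measure))"
  using distribution by (simp add: distribution_on_def)

sublocale prob_space D
  using distribution by (simp add: distribution_on_def)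

lemma coordinate_measurable [measurable]: "j < d \<Longrightarrow> (\<lambda>y. y j) \<in> borel_measurable D"
  unfolding measurable_cong_sets[OF sets_D refl]
  by (intro measurable_component_singleton) auto

lemma vec_norm_measurable [measurable]: "vec_norm d \<in> borel_measurable D"
  unfolding vec_norm_def L2_set_def by measurable

lemma coordinate_integrable: "j < d \<Longrightarrow> integrable D (\<lambda>y. y j)"
  and coordinate_mean: "j < d \<Longrightarrow> (LINT y|D. y j) = 0"
  using mean0 by (auto simp: has_mean_def has_bochner_integral_iff)

text \<open>The supremum in \<open>moment_sigma\<close> is tested on the \<open>j\<close>-th unit
  vector, where centring changes nothing because the mean is zero.\<close>

lemma coordinate_moment:
  assumes j: "j < d"
  shows "(\<integral>\<^sup>+ y. ennreal (\<bar>y j\<bar> powr k) \<partial>D) \<le> 1"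
proof -
  define v where "v = (\<lambda>i. if i = j then 1 else 0 :: real)"
  have v: "vec_norm d v = 1"
    using j by (simp add: v_def vec_norm_def L2_set_def if_distrib[of "\<lambda>z. z\<^sup>2"] sum.delta cong: if_cong)
  have vi: "vec_inner d (\<lambda>i. y i - vec_mean D i) v = y j" for y
    using j coordinate_mean[OF j]
    by (simp add: v_def vec_inner_def vec_mean_def if_distrib sum.delta cong: if_cong)
  let ?I = "\<integral>\<^sup>+ y. ennreal (\<bar>y j\<bar> powr k) \<partial>D"
  have "ennreal_powr ?I (1 / k) \<le> moment_sigma d k D"
    unfolding moment_sigma_def using v by (intro SUP_upper2[of v]) (auto simp: vi)
  then have le1: "ennreal_powr ?I (1 / k) \<le> 1" using moment by order
  \<comment> \<open>Finiteness has to come before \<open>enn2real\<close>, which sends infinity to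
    0; it holds because \<open>ennreal_powr\<close> preserves infinity.\<close>
  then have fin: "?I \<noteq> top" by (auto simp: ennreal_powr_def top_unique split: if_splits)
  with le1 have "enn2real ?I powr (1 / k) \<le> 1"
    by (simp add: ennreal_powr_def)
  then have "enn2real ?I \<le> 1"
    using k powr_less_mono2[of "1 / k" 1 "enn2real ?I"] by fastforce
  then show ?thesis using fin by (metis ennreal_enn2real ennreal_le_1 top.not_eq_extremum)
qed

text \<open>Both claims come from a pointwise comparison with
  \<open>1 + \<bar>z\<bar> powr k\<close>, split at absolute value 1. The bound 2 turns the factor 3
  of the one-step estimate into the later 6.\<close>

lemma coordinate_square:
  assumes j: "j < d"
  shows "integrable D (\<lambda>y. (y j)\<^sup>2)" "(LINT y|D. (y j)\<^sup>2) \<le> 2"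
proof -
  have pw: "z\<^sup>2 \<le> 1 + \<bar>z\<bar> powr k" for z :: real
  proof (cases "\<bar>z\<bar> \<le> 1")
    case True
    then have "z\<^sup>2 \<le> 1" by (simp add: abs_square_le_1)
    then show ?thesis by (smt (verit) powr_ge_zero)
  next
    case False
    then have "\<bar>z\<bar> powr 2 \<le> \<bar>z\<bar> powr k" using k by (intro powr_mono) auto
    then show ?thesis using False by (simp add: powr_numeral)
  qed
  have "(\<integral>\<^sup>+ y. ennreal ((y j)\<^sup>2) \<partial>D) \<le> (\<integral>\<^sup>+ y. 1 + ennreal (\<bar>y j\<bar> powr k) \<partial>D)"
    using pw by (intro nn_integral_mono) (simp flip: ennreal_1 ennreal_plus)
  also have "\<dots> = 1 + (\<integral>\<^sup>+ y. ennreal (\<bar>y j\<bar> powr k) \<partial>D)"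
    using j by (subst nn_integral_add) (auto simp: emeasure_space_1)
  also have "\<dots> \<le> 1 + 1" by (intro add_left_mono coordinate_moment j)
  finally have le: "(\<integral>\<^sup>+ y. ennreal ((y j)\<^sup>2) \<partial>D) \<le> 2" by simp
  show int: "integrable D (\<lambda>y. (y j)\<^sup>2)"
    using j le by (intro integrableI_bounded) (auto simp: le_less_trans)
  show "(LINT y|D. (y j)\<^sup>2) \<le> 2"
    using le nn_integral_eq_integral[OF int] by (simp flip: ennreal_numeral)
qed

text \<open>Markov's inequality for the \<open>k\<close>-th power of the norm: the \<open>d\<close>
  coordinate moments, each at most 1, supply the factor missing from
  \<open>d powr (k / 2 - 1)\<close>.\<close>

lemma tail_le:
  assumes R: "R > 0"
  shows "measure D {y \<in> space D. R < vec_norm d y} \<le> real d powr (k / 2) / R powr k"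
proof -
  have "emeasure D {y \<in> space D. R < vec_norm d y}
      \<le> emeasure D {y \<in> space D. 1 \<le> ennreal (1 / R powr k) * ennreal (vec_norm d y powr k)}"
  proof (intro emeasure_mono Collect_mono conj_mono impI)
    fix y assume "R < vec_norm d y"
    then have "R powr k \<le> vec_norm d y powr k" using R k by (intro powr_mono2) auto
    then have "1 \<le> (1 / R powr k) * vec_norm d y powr k" using R by (simp add: field_simps)
    then show "1 \<le> ennreal (1 / R powr k) * ennreal (vec_norm d y powr k)"
      by (simp flip: ennreal_mult ennreal_1)
  qed auto
  also have "\<dots> \<le> ennreal (1 / R powr k)
      * (\<integral>\<^sup>+ y. ennreal (vec_norm d y powr k) * indicator (space D) y \<partial>D)"
    by (rule nn_integral_Markov_inequality) auto
  also have "(\<integral>\<^sup>+ y. ennreal (vec_norm d y powr k) * indicator (space D) y \<partial>D)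
      \<le> (\<integral>\<^sup>+ y. ennreal (real d powr (k / 2 - 1)) * (\<Sum>j<d. ennreal (\<bar>y j\<bar> powr k)) \<partial>D)"
    using vec_norm_powr_le[OF d, of k] k
    by (intro nn_integral_mono)
       (auto simp: sum_ennreal sum_nonneg simp flip: ennreal_mult split: split_indicator
             intro!: ennreal_leI)
  also have "\<dots> = ennreal (real d powr (k / 2 - 1)) * (\<Sum>j<d. \<integral>\<^sup>+ y. ennreal (\<bar>y j\<bar> powr k) \<partial>D)"
    by (subst nn_integral_cmult, measurable) (subst nn_integral_sum, auto)
  also have "\<dots> \<le> ennreal (real d powr (k / 2 - 1)) * (\<Sum>j<d. 1)"
    by (intro mult_left_mono sum_mono coordinate_moment) auto
  also have "\<dots> = ennreal (real d powr (k / 2 - 1) * real d)"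
    by (simp add: ennreal_mult ennreal_of_nat_eq_real_of_nat)
  also have "real d powr (k / 2 - 1) * real d = real d powr (k / 2)"
    using d by (simp add: powr_diff)
  finally show ?thesis
    by (simp add: emeasure_eq_measure mult_left_mono flip: ennreal_mult)
qed

section \<open>Exponential moment of the truncated sum\<close>

text \<open>Here \<open>x\<close> is the sum so far and \<open>y\<close> the next sample. The linear
  term integrates to zero, and \<open>1 + z \<le> exp z\<close> handles the quadratic one. The
  growth factor does not depend on \<open>x\<close>, so the bound can be iterated.\<close>

lemma integral_exp_smooth_norm_le:
  assumes l: "0 < l" and R: "l * R = 1 / 2"
  shows "(\<integral>\<^sup>+ y. ennreal (exp (smooth_norm d (\<lambda>j. x j + l * truncate d R y j))) \<partial>D)
    \<le> ennreal (exp (smooth_norm d x) * exp (6 * l\<^sup>2 * real d))"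
proof -
  define g where "g = (\<lambda>y. exp (smooth_norm d x)
        * (1 + l * vec_inner d x y / smooth_norm d x + 3 * l\<^sup>2 * (vec_norm d y)\<^sup>2))"
  have le: "exp (smooth_norm d (\<lambda>j. x j + l * truncate d R y j)) \<le> g y" for y
    unfolding g_def by (rule exp_smooth_norm_truncate_le[OF l R])
  have g0: "0 \<le> g y" for y
    using le[of y] by (meson exp_ge_zero order_trans)
  have inner: "integrable D (vec_inner d x)" "(LINT y|D. vec_inner d x y) = 0"
    unfolding vec_inner_def
    by (auto simp: coordinate_integrable coordinate_mean)
  have norm: "integrable D (\<lambda>y. (vec_norm d y)\<^sup>2)"
    unfolding vec_norm_power2 by (auto simp: coordinate_square)
  have "(LINT y|D. (vec_norm d y)\<^sup>2) = (\<Sum>j<d. LINT y|D. (y j)\<^sup>2)"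
    unfolding vec_norm_power2 by (simp add: coordinate_square)
  also have "\<dots> \<le> (\<Sum>j<d. 2)" by (intro sum_mono coordinate_square) auto
  finally have norm_le: "(LINT y|D. (vec_norm d y)\<^sup>2) \<le> 2 * real d" by simp
  have int: "integrable D g"
    unfolding g_def using inner norm by auto
  have "(\<integral>\<^sup>+ y. ennreal (exp (smooth_norm d (\<lambda>j. x j + l * truncate d R y j))) \<partial>D)
      \<le> (\<integral>\<^sup>+ y. ennreal (g y) \<partial>D)"
    by (intro nn_integral_mono ennreal_leI le)
  also have "\<dots> = ennreal (LINT y|D. g y)"
    by (rule nn_integral_eq_integral[OF int]) (simp add: g0)
  also have "(LINT y|D. g y)
      = exp (smooth_norm d x) * (1 + 3 * l\<^sup>2 * (LINT y|D. (vec_norm d y)\<^sup>2))"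
    unfolding g_def using inner norm by (simp add: prob_space)
  also have "\<dots> \<le> exp (smooth_norm d x) * exp (6 * l\<^sup>2 * real d)"
  proof (intro mult_left_mono)
    have "1 + 3 * l\<^sup>2 * (LINT y|D. (vec_norm d y)\<^sup>2) \<le> 1 + 3 * l\<^sup>2 * (2 * real d)"
      using norm_le by (intro add_left_mono mult_left_mono) auto
    also have "\<dots> \<le> exp (6 * l\<^sup>2 * real d)"
      using exp_ge_add_one_self[of "6 * l\<^sup>2 * real d"] by (simp add: mult.assoc)
    finally show "1 + 3 * l\<^sup>2 * (LINT y|D. (vec_norm d y)\<^sup>2) \<le> exp (6 * l\<^sup>2 * real d)" .
  qed simp
  finally show ?thesis by (simp add: ennreal_leI)
qed

lemma truncate_measurable [measurable]:
  "j < d \<Longrightarrow> (\<lambda>y. truncate d R y j) \<in> borel_measurable D"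
  unfolding truncate_def if_distribR by measurable

lemma component_truncate_measurable [measurable]:
  assumes "j < d" "i \<in> I"
  shows "(\<lambda>X. truncate d R (X i) j) \<in> borel_measurable (Pi\<^sub>M I (\<lambda>_. D))"
  by (rule measurable_compose[OF measurable_component_singleton[OF assms(2)]
        truncate_measurable[OF assms(1)]])

lemma smooth_norm_sum_measurable [measurable]:
  "J \<subseteq> I \<Longrightarrow> (\<lambda>X. smooth_norm d (\<lambda>j. \<Sum>i\<in>J. l * truncate d R (X i) j))
     \<in> borel_measurable (Pi\<^sub>M I (\<lambda>_. D))"
  unfolding smooth_norm_def by measurable auto

sublocale product_sigma_finite "\<lambda>_ :: nat. D" ..

text \<open>By Fubini the newest sample is integrated out first with the others fixed, each costing
  one growth factor.\<close>

lemma integral_exp_smooth_norm_sum_le: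
  assumes l: "0 < l" and R: "l * R = 1 / 2" and "finite (I :: nat set)"
  shows "(\<integral>\<^sup>+ X. ennreal (exp (smooth_norm d (\<lambda>j. \<Sum>i\<in>I. l * truncate d R (X i) j)))
           \<partial>Pi\<^sub>M I (\<lambda>_. D))
    \<le> ennreal (exp (1 + 6 * l\<^sup>2 * real d * real (card I)))"
  using \<open>finite I\<close>
proof induction
  case empty
  \<comment> \<open>The potential of the zero vector is \<open>exp 1\<close>, whence the 1 in the
    exponent.\<close>
  show ?case by (subst nn_integral_empty) (auto simp: smooth_norm_def)
next
  case (insert a I)
  let ?c = "exp (6 * l\<^sup>2 * real d)"
  let ?f = "\<lambda>I X. exp (smooth_norm d (\<lambda>j. \<Sum>i\<in>I. l * truncate d R (X i) j))"
  have "(\<integral>\<^sup>+ X. ennreal (?f (insert a I) X) \<partial>Pi\<^sub>M (insert a I) (\<lambda>_. D))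
      = (\<integral>\<^sup>+ X. (\<integral>\<^sup>+ y. ennreal (?f (insert a I) (X(a := y))) \<partial>D) \<partial>Pi\<^sub>M I (\<lambda>_. D))"
    using insert.hyps by (intro product_nn_integral_insert) measurable
  also have "\<dots> \<le> (\<integral>\<^sup>+ X. ennreal ?c * ennreal (?f I X) \<partial>Pi\<^sub>M I (\<lambda>_. D))"
  proof (intro nn_integral_mono)
    fix X :: "nat \<Rightarrow> nat \<Rightarrow> real"
    have "(\<Sum>i\<in>I. l * truncate d R ((X(a := y)) i) j) = (\<Sum>i\<in>I. l * truncate d R (X i) j)" for y j
      using insert.hyps by (intro sum.cong) auto
    then have "?f (insert a I) (X(a := y))
        = exp (smooth_norm d (\<lambda>j. (\<Sum>i\<in>I. l * truncate d R (X i) j) + l * truncate d R y j))" for y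
      using insert.hyps by (simp add: add.commute)
    then show "(\<integral>\<^sup>+ y. ennreal (?f (insert a I) (X(a := y))) \<partial>D) \<le> ennreal ?c * ennreal (?f I X)"
      using integral_exp_smooth_norm_le[OF l R, of "\<lambda>j. \<Sum>i\<in>I. l * truncate d R (X i) j"]
      by (simp add: mult.commute flip: ennreal_mult)
  qed
  also have "\<dots> = ennreal ?c * (\<integral>\<^sup>+ X. ennreal (?f I X) \<partial>Pi\<^sub>M I (\<lambda>_. D))"
    by (intro nn_integral_cmult) measurable
  also have "\<dots> \<le> ennreal ?c * ennreal (exp (1 + 6 * l\<^sup>2 * real d * real (card I)))"
    by (intro mult_left_mono insert.IH) simp
  also have "\<dots> = ennreal (exp (1 + 6 * l\<^sup>2 * real d * real (card (insert a I))))"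
    using insert.hyps by (simp add: algebra_simps flip: ennreal_mult exp_add)
  finally show ?case .
qed

section \<open>Tail bounds for the sample mean\<close>

text \<open>The first term is a union bound over samples longer than \<open>R\<close>; the second is
  Markov's inequality for the potential of the truncated sum.\<close>

lemma mean_tail_prob_le:
  assumes l: "0 < l" and R: "l * R = 1 / 2" and m: "m \<ge> 1"
  shows "mean_tail_prob d m D t
    \<le> real m * (real d powr (k / 2) / R powr k)
      + exp (1 + 6 * l\<^sup>2 * real d * real m - l * real m * t)"
proof -
  let ?P = "Pi\<^sub>M {..<m} (\<lambda>_. D)"
  interpret P: prob_space ?P by (rule prob_space_PiM) unfold_locales
  have R0: "R > 0" using l R by (metis zero_less_divide_1_iff zero_less_mult_pos zero_less_numeral)
  define T where "T = (\<lambda>X. smooth_norm d (\<lambda>j. \<Sum>i<m. l * truncate d R (X i) j))"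
  have T [measurable]: "T \<in> borel_measurable ?P"
    unfolding T_def by measurable
  define A where "A = (\<lambda>i. {X \<in> space ?P. R < vec_norm d (X i)})"
  define B where "B = {X \<in> space ?P. l * real m * t \<le> T X}"
  have comp [measurable]: "(\<lambda>X. X i) \<in> measurable ?P D" if "i < m" for i
    using that by (intro measurable_component_singleton) auto
  have A: "A i \<in> sets ?P" if "i < m" for i
    unfolding A_def using that by measurable
  have B: "B \<in> sets ?P" unfolding B_def by measurable
  \<comment> \<open>If no sample is longer than \<open>R\<close>, truncation changes nothing and the
    scaled sum is \<open>l * real m\<close> times the sample mean.\<close>
  have sub: "{X \<in> space ?P. t \<le> vec_norm d (sample_mean m X)} \<subseteq> (\<Union>i<m. A i) \<union> B"
  proof (intro subsetI, rule ccontr)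
    fix X assume X: "X \<in> {X \<in> space ?P. t \<le> vec_norm d (sample_mean m X)}"
      and nX: "X \<notin> (\<Union>i<m. A i) \<union> B"
    have "truncate d R (X i) = X i" if "i < m" for i
      using X nX that by (auto simp: A_def truncate_def not_less)
    then have "(\<lambda>j. \<Sum>i<m. l * truncate d R (X i) j) = (\<lambda>j. (l * real m) * sample_mean m X j)"
      using m by (auto simp: sample_mean_def simp flip: sum_distrib_left)
    then have "T X \<ge> vec_norm d (\<lambda>j. (l * real m) * sample_mean m X j)"
      unfolding T_def by (simp only: vec_norm_le_smooth_norm)
    moreover have "vec_norm d (\<lambda>j. (l * real m) * sample_mean m X j) \<ge> l * real m * t"
      using X l by (simp add: vec_norm_scale mult_left_mono)
    ultimately show False using X nX by (auto simp: B_def)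
  qed
  have PA: "measure ?P (A i) \<le> real d powr (k / 2) / R powr k" if "i < m" for i
  proof -
    have "measure ?P (A i) = measure (distr ?P D (\<lambda>X. X i)) {y \<in> space D. R < vec_norm d y}"
      using that measurable_space[OF comp[OF that]]
      by (subst measure_distr) (auto simp: A_def intro!: arg_cong[where f = "measure ?P"])
    also have "distr ?P D (\<lambda>X. X i) = D"
      using that by (intro distr_PiM_component prob_space_axioms) auto
    finally show ?thesis using tail_le[OF R0] by simp
  qed
  have "emeasure ?P B \<le> emeasure ?P {X \<in> space ?P.
      1 \<le> ennreal (exp (- (l * real m * t))) * ennreal (exp (T X))}"
    unfolding B_def
    by (intro emeasure_mono Collect_mono conj_mono)
       (auto simp flip: ennreal_mult exp_add ennreal_1)
  also have "\<dots> \<le> ennreal (exp (- (l * real m * t)))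
      * (\<integral>\<^sup>+ X. ennreal (exp (T X)) * indicator (space ?P) X \<partial>?P)"
    by (rule nn_integral_Markov_inequality) auto
  also have "(\<integral>\<^sup>+ X. ennreal (exp (T X)) * indicator (space ?P) X \<partial>?P)
      = (\<integral>\<^sup>+ X. ennreal (exp (T X)) \<partial>?P)"
    by (intro nn_integral_cong) auto
  also have "\<dots> \<le> ennreal (exp (1 + 6 * l\<^sup>2 * real d * real m))"
    using integral_exp_smooth_norm_sum_le[OF l R, of "{..<m}"] by (simp add: T_def)
  finally have "emeasure ?P B
      \<le> ennreal (exp (- (l * real m * t))) * ennreal (exp (1 + 6 * l\<^sup>2 * real d * real m))"
    by (simp add: mult_left_mono)
  then have PB: "measure ?P B \<le> exp (1 + 6 * l\<^sup>2 * real d * real m - l * real m * t)"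
    by (simp add: P.emeasure_eq_measure algebra_simps flip: ennreal_mult exp_add)
  have "mean_tail_prob d m D t \<le> measure ?P ((\<Union>i<m. A i) \<union> B)"
    unfolding mean_tail_prob_def using A B by (intro P.finite_measure_mono sub) auto
  also have "\<dots> \<le> measure ?P (\<Union>i<m. A i) + measure ?P B"
    using A B by (intro measure_Un_le) auto
  also have "measure ?P (\<Union>i<m. A i) \<le> (\<Sum>i<m. measure ?P (A i))"
    using A by (intro measure_UNION_le) auto
  also have "\<dots> \<le> (\<Sum>i<m. real d powr (k / 2) / R powr k)"
    by (intro sum_mono PA) auto
  finally show ?thesis using PB by simp
qed

text \<open>The lower bound on \<open>t\<close> makes the variance part of the exponent at most half
  of the linear gain; the upper bound keeps the polynomial term above the exponential
  remainder.\<close>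

lemma mean_tail_prob_le_polynomial:
  assumes m: "m \<ge> 2"
    and t1: "24 * (k - 1) * (real d * ln (real m) / real m) \<le> t\<^sup>2" and t: "0 < t" "t \<le> sqrt (real d)"
  shows "mean_tail_prob d m D t
    \<le> ((4 * (k - 1) * ln (real m)) powr k + exp 1)
       * (real d powr (k / 2) / (real m powr (k - 1) * t powr k))"
proof -
  \<comment> \<open>The factor 2 ensures that the half of \<open>L\<close> left after the variance
    term still yields \<open>real m powr (k - 1)\<close> in the denominator.\<close>
  define L where "L = 2 * (k - 1) * ln (real m)"
  have L: "L > 0" using m k by (simp add: L_def)
  define l where "l = L / (real m * t)"
  define R where "R = real m * t / (2 * L)"
  have m0: "real m > 0" using m by simp
  have l: "l > 0" and lR: "l * R = 1 / 2" and lmt: "l * real m * t = L"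
    using L m0 t by (auto simp: l_def R_def field_simps)
  define B where "B = real d powr (k / 2) / (real m powr (k - 1) * t powr k)"
  have poly: "real m * (real d powr (k / 2) / R powr k) = (2 * L) powr k * B"
    using m0 t L by (simp add: B_def R_def powr_divide powr_mult powr_diff field_simps)
  \<comment> \<open>After inserting \<open>l\<close>, this says that \<open>12 * L * real d\<close>
    is at most \<open>real m * t\<^sup>2\<close>, which is the assumed lower bound on
    \<open>t\<close> and explains its constant 24.\<close>
  have quad: "6 * l\<^sup>2 * real d * real m \<le> L / 2"
  proof -
    have "12 * (L * real d) \<le> real m * t\<^sup>2"
      using t1 m0 by (simp add: L_def field_simps)
    then have "L * (12 * (L * real d)) \<le> L * (real m * t\<^sup>2)" using L by simp
    then show ?thesis using m0 t by (simp add: l_def field_simps power2_eq_square)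
  qed
  \<comment> \<open>For \<open>t\<close> up to \<open>sqrt (real d)\<close> the quotient of
    \<open>real d powr (k / 2)\<close> by \<open>t powr k\<close> is at least 1.\<close>
  have small: "exp (1 - L / 2) \<le> exp 1 * B"
  proof -
    have "exp (1 - L / 2) = exp 1 * (1 / real m powr (k - 1))"
      using m0 by (simp add: L_def exp_diff powr_def)
    also have "1 / real m powr (k - 1) \<le> B"
    proof -
      have "t powr k \<le> sqrt (real d) powr k" using t k by (intro powr_mono2) auto
      also have "\<dots> = real d powr (k / 2)" by (simp add: powr_powr flip: powr_half_sqrt)
      finally show ?thesis using m0 t by (simp add: B_def field_simps)
    qed
    finally show ?thesis by simp
  qed
  have "mean_tail_prob d m D t
      \<le> real m * (real d powr (k / 2) / R powr k)
        + exp (1 + 6 * l\<^sup>2 * real d * real m - l * real m * t)"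
    using m by (intro mean_tail_prob_le l lR) auto
  also have "exp (1 + 6 * l\<^sup>2 * real d * real m - l * real m * t) \<le> exp (1 - L / 2)"
    using quad by (simp add: lmt)
  also note small
  also note poly
  also have "2 * L = 4 * (k - 1) * ln (real m)" by (simp add: L_def)
  finally show ?thesis by (simp only: B_def distrib_right)
qed

end

section \<open>Thresholds and constants uniform in dimension and sample size\<close>

theorem theorem4p5:
  fixes k :: real
  assumes "k > 2"
  shows "\<exists>(t1 :: nat \<Rightarrow> nat \<Rightarrow> real) (t2 :: nat \<Rightarrow> nat \<Rightarrow> real) (C1 :: real) (c2 :: real) (C :: real) (p :: nat).
    C1 > 0 \<and> c2 > 0 \<and> C > 0 \<and>
    (\<forall>d m. d \<ge> 1 \<longrightarrow> m \<ge> 2 \<longrightarrow>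
      0 < t1 d m \<and>
      t1 d m \<le> C1 * sqrt (real d * ln (real m) / real m) \<and>
      t2 d m \<ge> c2 * (sqrt (real d) * ln (real m) powr (- (1 / (k - 2)))) \<and>
      (\<forall>D. distribution_on d D \<longrightarrow> has_mean d D (\<lambda>_. 0) \<longrightarrow> moment_sigma d k D \<le> 1 \<longrightarrow>
        (\<forall>t. t1 d m \<le> t \<longrightarrow> t \<le> t2 d m \<longrightarrow>
          mean_tail_prob d m D t
            \<le> C * ln (real m) ^ p *
               (real d powr (k / 2) / (real m powr (k - 1) * t powr k)
                + exp (- (real m * t\<^sup>2 / real d))))))"
proof -
  define C1 where "C1 = sqrt (24 * (k - 1))"
  \<comment> \<open>The negative power of \<open>ln (real m)\<close> is largest at
    \<open>m = 2\<close>; \<open>c2\<close> cancels that value, so \<open>sqrt (real d)\<close> is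
    an admissible \<open>t2\<close> for every \<open>m\<close>.\<close>
  define c2 where "c2 = ln 2 powr (1 / (k - 2))"
  \<comment> \<open>Rounding \<open>k\<close> up gives a natural exponent for the logarithm.\<close>
  define p where "p = nat \<lceil>k\<rceil>"
  define K where "K = (4 * (k - 1)) powr k + exp 1"
  define C where "C = K / ln 2 ^ p"
  define t1 where "t1 = (\<lambda>d m :: nat. C1 * sqrt (real d * ln (real m) / real m))"
  define t2 where "t2 = (\<lambda>d m :: nat. sqrt (real d))"
  have ln2: "0 < ln (2 :: real)" "ln (2 :: real) \<le> 1"
    using ln_le_minus_one[of "2 :: real"] by auto
  have K: "K > 0" unfolding K_def by (intro add_nonneg_pos) auto
  have pos: "C1 > 0" "c2 > 0" "C > 0"
    using assms ln2 K by (auto simp: C1_def c2_def C_def)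
  have main: "0 < t1 d m \<and>
      t1 d m \<le> C1 * sqrt (real d * ln (real m) / real m) \<and>
      t2 d m \<ge> c2 * (sqrt (real d) * ln (real m) powr (- (1 / (k - 2)))) \<and>
      (\<forall>D. distribution_on d D \<longrightarrow> has_mean d D (\<lambda>_. 0) \<longrightarrow> moment_sigma d k D \<le> 1 \<longrightarrow>
        (\<forall>t. t1 d m \<le> t \<longrightarrow> t \<le> t2 d m \<longrightarrow>
          mean_tail_prob d m D t
            \<le> C * ln (real m) ^ p *
               (real d powr (k / 2) / (real m powr (k - 1) * t powr k)
                + exp (- (real m * t\<^sup>2 / real d)))))"
    if d: "d \<ge> 1" and m: "m \<ge> 2" for d m
  proof (intro conjI allI impI)
    have lnm: "ln 2 \<le> ln (real m)" using m by simp
    show t1: "0 < t1 d m" using pos d m by (simp add: t1_def)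
    show "t1 d m \<le> C1 * sqrt (real d * ln (real m) / real m)" by (simp add: t1_def)
    have "c2 * ln (real m) powr (- (1 / (k - 2))) \<le> c2 * ln 2 powr (- (1 / (k - 2)))"
      using assms lnm ln2 pos by (intro mult_left_mono powr_mono2') auto
    also have "\<dots> = 1" using ln2 by (simp add: c2_def flip: powr_add)
    finally have "sqrt (real d) * (c2 * ln (real m) powr (- (1 / (k - 2)))) \<le> sqrt (real d) * 1"
      by (intro mult_left_mono) auto
    then show "t2 d m \<ge> c2 * (sqrt (real d) * ln (real m) powr (- (1 / (k - 2))))"
      by (simp add: t2_def mult_ac)
    fix D t
    assume D: "distribution_on d D" "has_mean d D (\<lambda>_. 0)" "moment_sigma d k D \<le> 1"
      and t: "t1 d m \<le> t" "t \<le> t2 d m"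
    interpret centered_distribution d k D by unfold_locales (use d assms D in auto)
    let ?B = "real d powr (k / 2) / (real m powr (k - 1) * t powr k)"
    \<comment> \<open>Since \<open>ln 2\<close> is below 1, the logarithm is normalised to be at
      least 1; then raising the exponent from \<open>k\<close> to \<open>p\<close> and absorbing
      \<open>exp 1\<close> are both monotone. The division by \<open>ln 2 ^ p\<close> in
      \<open>C\<close> undoes this.\<close>
    define w where "w = ln (real m) / ln 2"
    have w: "w \<ge> 1" using lnm ln2 by (simp add: w_def)
    have "(t1 d m)\<^sup>2 = 24 * (k - 1) * (real d * ln (real m) / real m)"
      using assms m by (simp add: t1_def C1_def power_mult_distrib)
    then have "24 * (k - 1) * (real d * ln (real m) / real m) \<le> t\<^sup>2"
      using t t1 power_mono[of "t1 d m" t 2] by simp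
    then have "mean_tail_prob d m D t \<le> ((4 * (k - 1) * ln (real m)) powr k + exp 1) * ?B"
      using m t t1 by (intro mean_tail_prob_le_polynomial) (auto simp: t2_def)
    also have "\<dots> \<le> (K * w ^ p) * ?B"
    proof (intro mult_right_mono)
      have "ln (real m) * ln 2 \<le> ln (real m) * 1"
        using ln2 lnm by (intro mult_left_mono) linarith+
      then have "ln (real m) \<le> w" using ln2 by (simp add: w_def le_divide_eq)
      then have "(4 * (k - 1) * ln (real m)) powr k \<le> (4 * (k - 1) * w) powr k"
        using assms m by (intro powr_mono2 mult_left_mono) auto
      also have "\<dots> = (4 * (k - 1)) powr k * w powr k"
        using assms w by (simp add: powr_mult)
      also have "w powr k \<le> w powr real p"
        using w by (intro powr_mono) (auto simp: p_def real_nat_ceiling_ge)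
      also have "w powr real p = w ^ p" using w by (simp add: powr_realpow)
      finally have 1: "(4 * (k - 1) * ln (real m)) powr k \<le> (4 * (k - 1)) powr k * w ^ p"
        by (simp add: mult_left_mono)
      have "exp 1 * 1 \<le> exp (1 :: real) * w ^ p"
        using w by (intro mult_left_mono one_le_power) auto
      with 1 show "(4 * (k - 1) * ln (real m)) powr k + exp 1 \<le> K * w ^ p"
        unfolding K_def distrib_right by linarith
    qed auto
    also have "K * w ^ p = C * ln (real m) ^ p"
      by (simp add: C_def w_def power_divide)
    \<comment> \<open>The Gaussian term is nonnegative, so adding it preserves the bound.\<close>
    also have "C * ln (real m) ^ p * ?B
        \<le> C * ln (real m) ^ p * (?B + exp (- (real m * t\<^sup>2 / real d)))"
      using pos m by (intro mult_left_mono) auto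
    finally show "mean_tail_prob d m D t
        \<le> C * ln (real m) ^ p * (?B + exp (- (real m * t\<^sup>2 / real d)))" .
  qed
  show ?thesis
    by (rule exI[of _ t1], rule exI[of _ t2], rule exI[of _ C1], rule exI[of _ c2],
        rule exI[of _ C], rule exI[of _ p]) (use pos main in blast)
qed

end
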